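(* The PageRank protocol (written out in the context) for computing the PageRank centrality is data-oblivious: its control flow and memory access pattern reveal nothing about the input other than the public values $n$ (number of vertices), $m$ (number of edges) and $l$ (number of iterations); that is, the sequence of primitive operations and ORAM accesses it performs depends only on $n$, $m$ and $l$.
   Context: **Graphs and representation.** $G=(V,E)$ is a directed graph with $V=\{1,\dots,n\}$ and $|E|=m$. The edgelist representation is a pair $(\mathcal{E},Idx)$. $\mathcal{E}$ is an array of length $m+1$ consisting of the concatenated adjacency lists (out-neighbours) of vertices $1,2,\dots,n$ in this order, followed by one empty element. $Idx[u]$ is the position in $\mathcal{E}$ of the first neighbour of $u$ if out-degree$(u)\neq 0$; $Idx[u]=Idx[u+1]$ if $u\ne n$ and out-degree$(u)=0$; $Idx[n]=m+1$ if out-degree$(n)=0$. Convention: $Idx[n+1]=m+1$. **Model of computation.** An algorithm is data-oblivious if its control flow and memory access pattern do not leak any information about the input other than its length (here $n$ and $m$) and public values. Values are public or private. The operations $+,*,/,<,>,==$ on integers and rationals are primitive operations whose operands are hidden. The arrays $N,\mathcal{E},Idx,r^{(0)},r^{(1)}$ are stored in an Oblivious RAM (ORAM): a read or write at a private index reveals which array is accessed, but not the index or the content. An if-else is executed by running both branches one after the other, only one of them taking effect and the other being executed in a dummy fashion; an if without else is treated likewise. **The PageRank protocol.** Input: $(\mathcal{E},Idx)$, public number of iterations $l$, private redistribution parameter $s$. 1. For $i=1$ to $n$, for $j=1$ to $n$: if $Idx[i]=Idx[i+1]$ then $N[i][j]\leftarrow (1-s)/n$, else $N[i][j]\leftarrow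 s/(Idx[i+1]-Idx[i])+(1-s)/n$. 2. $r^{(0)}[i]\leftarrow 1/n$ and $r^{(1)}[i]\leftarrow 0$ for $1\le i\le n$. Set $j\leftarrow 1$ ($j$ is public). 3. For $k=1$ to $l$: - $v\leftarrow 1$ ($v$ is private). - For $i=1$ to $m$: if $i=Idx[v+1]$ then $v\leftarrow v+1$; then $r^{(j)}[\mathcal{E}[i]]\leftarrow r^{(j)}[\mathcal{E}[i]]+N[v][\mathcal{E}[i]]*r^{(1-j)}[v]$. - $j\leftarrow 1-j$; then $r^{(j)}[i]\leftarrow 0$ for $1\le i\le n$. *)

theory Defs
  imports Main "HOL.Rat" "Graph_Theory.Pair_Digraph"
begin

section \<open>Graphs and their edgelist representation\<close>

text \<open>
  \<open>pair_fin_digraph\<close> excludes parallel arcs but allows loops. Vertices and array positions start at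
  \<open>1\<close>, so position \<open>p\<close> of an array given as a list is \<open>xs ! (p - 1)\<close>; \<open>None\<close> is the empty element.
\<close>

definition digraph_on :: "nat \<Rightarrow> nat \<Rightarrow> nat pair_pre_digraph \<Rightarrow> bool" where
  "digraph_on n m G \<longleftrightarrow> pair_fin_digraph G \<and> pverts G = {1..n} \<and> card (parcs G) = m"

definition edgelist_representation ::
  "nat \<Rightarrow> nat \<Rightarrow> nat pair_pre_digraph \<Rightarrow> nat option list \<Rightarrow> (nat \<Rightarrow> nat) \<Rightarrow> bool" where
  "edgelist_representation n m G \<E> Idx \<longleftrightarrow>
     (\<exists>adj :: nat \<Rightarrow> nat list.
        (\<forall>u\<in>{1..n}. distinct (adj u) \<and> set (adj u) = {w. (u, w) \<in> parcs G}) \<and>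
        \<E> = map Some (concat (map adj [1..<n+1])) @ [None] \<and>
        (\<forall>u\<in>{1..n}. out_degree (with_proj G) u \<noteq> 0 \<longrightarrow>
             Idx u = length (concat (map adj [1..<u])) + 1)) \<and>
     (\<forall>u\<in>{1..n}. u \<noteq> n \<and> out_degree (with_proj G) u = 0 \<longrightarrow> Idx u = Idx (u + 1)) \<and>
     (1 \<le> n \<and> out_degree (with_proj G) n = 0 \<longrightarrow> Idx n = m + 1) \<and>
     Idx (n + 1) = m + 1"


section \<open>Programs\<close>

type_synonym val = rat

datatype var = Pub string | Priv string

datatype primop = Add | Sub | Mul | Div | Less | Greater | Equal

text \<open>
  An array is identified by its name and an optional superscript, such as \<open>r\<close> and \<open>j\<close> in
  \<open>r\<^sup>(\<^sup>j\<^sup>)[i]\<close>. Syntactically the superscript is an expression: which array is accessed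
  may depend on the state.
\<close>

type_synonym array = "string \<times> val option"

datatype exp =
    Lit val
  | Var var
  | Op primop exp exp
  | Read string "exp option" "exp list"

datatype com =
    Skip
  | Assign var exp
  | Write string "exp option" "exp list" exp
  | Seq com com  (infixr ";;" 60)
  | If exp com com
  | For string exp exp com

record mem =
  vars :: "var \<Rightarrow> val"
  arrs :: "array \<Rightarrow> val list \<Rightarrow> val"

fun apply_op :: "primop \<Rightarrow> val \<Rightarrow> val \<Rightarrow> val" where
  "apply_op Add a b = a + b"
| "apply_op Sub a b = a - b"
| "apply_op Mul a b = a * b"
| "apply_op Div a b = a / b"
| "apply_op Less a b = (if a < b then 1 else 0)"
| "apply_op Greater a b = (if a > b then 1 else 0)"
| "apply_op Equal a b = (if a = b then 1 else 0)"

fun eval :: "mem \<Rightarrow> exp \<Rightarrow> val" where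
  "eval \<sigma> (Lit c) = c"
| "eval \<sigma> (Var x) = vars \<sigma> x"
| "eval \<sigma> (Op f a b) = apply_op f (eval \<sigma> a) (eval \<sigma> b)"
| "eval \<sigma> (Read A js is) = arrs \<sigma> (A, map_option (eval \<sigma>) js) (map (eval \<sigma>) is)"


section \<open>Observable behaviour\<close>

text \<open>
  Operands of primitive operations and contents of array cells are hidden. An access shows the array
  and those index components that are computed from public data only; the others appear as \<open>None\<close>.
  Setting a variable shows its new value exactly if the variable is public.
\<close>

datatype event =
    OpEv primop
  | ReadEv array "val option list"
  | WriteEv array "val option list"
  | SetEv var "val option"

fun public_exp :: "exp \<Rightarrow> bool" where
  "public_exp (Lit c) = True"
| "public_exp (Var (Pub x)) = True"
| "public_exp (Var (Priv x)) = False"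
| "public_exp (Op f a b) = (public_exp a \<and> public_exp b)"
| "public_exp (Read A js is) = False"

definition visible_index :: "mem \<Rightarrow> exp \<Rightarrow> val option" where
  "visible_index \<sigma> e = (if public_exp e then Some (eval \<sigma> e) else None)"

fun set_event :: "var \<Rightarrow> val \<Rightarrow> event" where
  "set_event (Pub x) a = SetEv (Pub x) (Some a)"
| "set_event (Priv x) a = SetEv (Priv x) None"

fun exp_trace :: "mem \<Rightarrow> exp \<Rightarrow> event list" where
  "exp_trace \<sigma> (Lit c) = []"
| "exp_trace \<sigma> (Var x) = []"
| "exp_trace \<sigma> (Op f a b) = exp_trace \<sigma> a @ exp_trace \<sigma> b @ [OpEv f]"
| "exp_trace \<sigma> (Read A js is) =
     (case js of None \<Rightarrow> [] | Some e \<Rightarrow> exp_trace \<sigma> e) @ concat (map (exp_trace \<sigma>) is) @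
     [ReadEv (A, map_option (eval \<sigma>) js) (map (visible_index \<sigma>) is)]"

definition set_var :: "var \<Rightarrow> val \<Rightarrow> mem \<Rightarrow> mem" where
  "set_var x a \<sigma> = \<sigma>\<lparr>vars := (vars \<sigma>)(x := a)\<rparr>"

definition set_cell :: "array \<Rightarrow> val list \<Rightarrow> val \<Rightarrow> mem \<Rightarrow> mem" where
  "set_cell A is a \<sigma> = \<sigma>\<lparr>arrs := (arrs \<sigma>)(A := (arrs \<sigma> A)(is := a))\<rparr>"

primrec iterate ::
  "string \<Rightarrow> (mem \<Rightarrow> mem \<times> event list) \<Rightarrow> val list \<Rightarrow> mem \<Rightarrow> mem \<times> event list" where
  "iterate x f [] \<sigma> = (\<sigma>, [])"
| "iterate x f (a # as) \<sigma> =
     (let (\<sigma>1, t1) = f (set_var (Pub x) a \<sigma>);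
          (\<sigma>2, t2) = iterate x f as \<sigma>1
      in (\<sigma>2, set_event (Pub x) a # t1 @ t2))"

text \<open>
  The flag tells whether commands take effect (\<open>True\<close>) or are executed in the dummy fashion
  (\<open>False\<close>), which produces the same kinds of events but leaves the memory unchanged. An
  assignment to a public variable shows the value the variable has afterwards, so
  assigning to a public variable under a private condition does leak. Loop counters are public,
  local to the loop, and run through their range in dummy executions too; the number of iterations
  is observable whatever the bounds are computed from.
\<close>

primrec exec :: "com \<Rightarrow> bool \<Rightarrow> mem \<Rightarrow> mem \<times> event list" where
  "exec Skip act \<sigma> = (\<sigma>, [])"
| "exec (Assign x e) act \<sigma> =
     (let \<sigma>' = (if act then set_var x (eval \<sigma> e) \<sigma> else \<sigma>)
      in (\<sigma>', exp_trace \<sigma> e @ [set_event x (vars \<sigma>' x)]))"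
| "exec (Write A js is e) act \<sigma> =
     (let A' = (A, map_option (eval \<sigma>) js) in
      (if act then set_cell A' (map (eval \<sigma>) is) (eval \<sigma> e) \<sigma> else \<sigma>,
       (case js of None \<Rightarrow> [] | Some e' \<Rightarrow> exp_trace \<sigma> e') @ concat (map (exp_trace \<sigma>) is) @
       exp_trace \<sigma> e @ [WriteEv A' (map (visible_index \<sigma>) is)]))"
| "exec (c1 ;; c2) act \<sigma> =
     (let (\<sigma>1, t1) = exec c1 act \<sigma>; (\<sigma>2, t2) = exec c2 act \<sigma>1 in (\<sigma>2, t1 @ t2))"
| "exec (If e c1 c2) act \<sigma> =
     (let b = (eval \<sigma> e \<noteq> 0);
          (\<sigma>1, t1) = exec c1 (act \<and> b) \<sigma>;
          (\<sigma>2, t2) = exec c2 (act \<and> \<not> b) \<sigma>1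
      in (\<sigma>2, exp_trace \<sigma> e @ t1 @ t2))"
| "exec (For x lo hi c) act \<sigma> =
     (let (\<sigma>', t) =
            iterate x (exec c act) (map of_int [\<lceil>eval \<sigma> lo\<rceil>..\<lfloor>eval \<sigma> hi\<rfloor>]) \<sigma>
      in (set_var (Pub x) (vars \<sigma> (Pub x)) \<sigma>', exp_trace \<sigma> lo @ exp_trace \<sigma> hi @ t))"

definition trace :: "com \<Rightarrow> mem \<Rightarrow> event list" where
  "trace c \<sigma> = snd (exec c True \<sigma>)"

text \<open>
  \<open>valid\<close> describes the initial memories that hold an admissible input, \<open>X\<close> the public part of it.
\<close>

definition data_oblivious :: "(mem \<Rightarrow> bool) \<Rightarrow> string set \<Rightarrow> com \<Rightarrow> bool" where
  "data_oblivious valid X c \<longleftrightarrow>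
     (\<forall>\<sigma> \<sigma>'. valid \<sigma> \<and> valid \<sigma>' \<and> (\<forall>x\<in>X. vars \<sigma> (Pub x) = vars \<sigma>' (Pub x)) \<longrightarrow>
        trace c \<sigma> = trace c \<sigma>')"


section \<open>The PageRank protocol\<close>

abbreviation (input) pub :: "string \<Rightarrow> exp" where "pub x \<equiv> Var (Pub x)"
abbreviation (input) priv :: "string \<Rightarrow> exp" where "priv x \<equiv> Var (Priv x)"
abbreviation (input) plus_exp (infixl "\<oplus>" 65) where "a \<oplus> b \<equiv> Op Add a b"
abbreviation (input) minus_exp (infixl "\<ominus>" 65) where "a \<ominus> b \<equiv> Op Sub a b"
abbreviation (input) times_exp (infixl "\<otimes>" 70) where "a \<otimes> b \<equiv> Op Mul a b"
abbreviation (input) divide_exp (infixl "\<oslash>" 70) where "a \<oslash> b \<equiv> Op Div a b"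
abbreviation (input) eq_exp (infix "\<doteq>" 50) where "a \<doteq> b \<equiv> Op Equal a b"

abbreviation (input) "N_at u w \<equiv> Read ''N'' None [u, w]"
abbreviation (input) "E_at p \<equiv> Read ''E'' None [p]"
abbreviation (input) "Idx_at u \<equiv> Read ''Idx'' None [u]"
abbreviation (input) "r_at j u \<equiv> Read ''r'' (Some j) [u]"

definition build_N :: com where
  "build_N =
     For ''i'' (Lit 1) (pub ''n'') (
       For ''j'' (Lit 1) (pub ''n'') (
         If (Idx_at (pub ''i'') \<doteq> Idx_at (pub ''i'' \<oplus> Lit 1))
           (Write ''N'' None [pub ''i'', pub ''j''] ((Lit 1 \<ominus> priv ''s'') \<oslash> pub ''n''))
           (Write ''N'' None [pub ''i'', pub ''j'']
              (priv ''s'' \<oslash> (Idx_at (pub ''i'' \<oplus> Lit 1) \<ominus> Idx_at (pub ''i''))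
               \<oplus> (Lit 1 \<ominus> priv ''s'') \<oslash> pub ''n''))))"

definition init_ranks :: com where
  "init_ranks =
     For ''i'' (Lit 1) (pub ''n'') (
       Write ''r'' (Some (Lit 0)) [pub ''i''] (Lit 1 \<oslash> pub ''n'') ;;
       Write ''r'' (Some (Lit 1)) [pub ''i''] (Lit 0)) ;;
     Assign (Pub ''j'') (Lit 1)"

definition iterate_ranks :: com where
  "iterate_ranks =
     For ''k'' (Lit 1) (pub ''l'') (
       Assign (Priv ''v'') (Lit 1) ;;
       For ''i'' (Lit 1) (pub ''m'') (
         If (pub ''i'' \<doteq> Idx_at (priv ''v'' \<oplus> Lit 1))
           (Assign (Priv ''v'') (priv ''v'' \<oplus> Lit 1))
           Skip ;;
         Write ''r'' (Some (pub ''j'')) [E_at (pub ''i'')]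
           (r_at (pub ''j'') (E_at (pub ''i''))
            \<oplus> N_at (priv ''v'') (E_at (pub ''i'')) \<otimes> r_at (Lit 1 \<ominus> pub ''j'') (priv ''v''))) ;;
       Assign (Pub ''j'') (Lit 1 \<ominus> pub ''j'') ;;
       For ''i'' (Lit 1) (pub ''n'') (
         Write ''r'' (Some (pub ''j'')) [pub ''i''] (Lit 0)))"

definition pagerank :: com where
  "pagerank = build_N ;; init_ranks ;; iterate_ranks"

text \<open>
  Everything not mentioned here, in particular the content of the empty last cell of \<open>E\<close> and the
  initial contents of \<open>N\<close>, \<open>r\<close> and the remaining variables, is arbitrary.
\<close>

definition pagerank_input ::
  "nat \<Rightarrow> nat \<Rightarrow> nat \<Rightarrow> rat \<Rightarrow> nat pair_pre_digraph \<Rightarrow> mem \<Rightarrow> bool" where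
  "pagerank_input n m l s G \<sigma> \<longleftrightarrow>
     digraph_on n m G \<and>
     (\<exists>\<E> Idx. edgelist_representation n m G \<E> Idx \<and>
        (\<forall>p\<in>{1..m+1}. \<forall>w. \<E> ! (p - 1) = Some w \<longrightarrow> arrs \<sigma> (''E'', None) [of_nat p] = of_nat w) \<and>
        (\<forall>u\<in>{1..n+1}. arrs \<sigma> (''Idx'', None) [of_nat u] = of_nat (Idx u))) \<and>
     vars \<sigma> (Pub ''n'') = of_nat n \<and>
     vars \<sigma> (Pub ''m'') = of_nat m \<and>
     vars \<sigma> (Pub ''l'') = of_nat l \<and>
     vars \<sigma> (Priv ''s'') = s"

end

theory Submission
  imports Defs
begin

text \<open>
  The protocol passes a syntactic information-flow check: public variables are assigned, loop bounds
  and array superscripts computed, from public data only, and no public variable is assigned inside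
  a branch of an if. Two runs of a program that passes this check produce the same trace as soon as
  the initial memories agree on the public variables read before being set, which here are
  \<open>n\<close>, \<open>m\<close> and \<open>l\<close>.
\<close>

definition agree :: "string set \<Rightarrow> mem \<Rightarrow> mem \<Rightarrow> bool" where
  "agree L \<sigma> \<sigma>' \<longleftrightarrow> (\<forall>x\<in>L. vars \<sigma> (Pub x) = vars \<sigma>' (Pub x))"

text \<open>This is meant to give equal traces, not equal values: private variables and cell indices
  may differ, since an index not computed from public data shows up as \<open>None\<close>. A
  superscript is always displayed, so it must be public.\<close>

fun low_exp :: "string set \<Rightarrow> exp \<Rightarrow> bool" where
  "low_exp L (Lit c) = True"
| "low_exp L (Var (Pub x)) = (x \<in> L)"
| "low_exp L (Var (Priv x)) = True"
| "low_exp L (Op f a b) = (low_exp L a \<and> low_exp L b)"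
| "low_exp L (Read A js is) =
     ((\<forall>e\<in>set_option js. public_exp e \<and> low_exp L e) \<and> (\<forall>e\<in>set is. low_exp L e))"

text \<open>A loop adds nothing, as it may run zero times and resets its counter; an if adds
  nothing, as either branch may be a dummy.\<close>

primrec low_after :: "com \<Rightarrow> string set \<Rightarrow> string set" where
  "low_after Skip L = L"
| "low_after (Assign x e) L = (case x of Pub y \<Rightarrow> insert y L | Priv y \<Rightarrow> L)"
| "low_after (Write A js is e) L = L"
| "low_after (c1 ;; c2) L = low_after c2 (low_after c1 L)"
| "low_after (If e c1 c2) L = L"
| "low_after (For x lo hi c) L = L"

text \<open>
  The flag \<open>u\<close> means that the command is known to take effect; inside a branch, one of two runs may
  take effect while the other one is a dummy execution.
\<close>

primrec low_com :: "com \<Rightarrow> bool \<Rightarrow> string set \<Rightarrow> bool" where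
  "low_com Skip u L = True"
| "low_com (Assign x e) u L =
     (low_exp L e \<and> (case x of Pub y \<Rightarrow> u \<and> public_exp e | Priv y \<Rightarrow> True))"
| "low_com (Write A js is e) u L = (low_exp L (Read A js is) \<and> low_exp L e)"
| "low_com (c1 ;; c2) u L = (low_com c1 u L \<and> low_com c2 u (low_after c1 L))"
| "low_com (If e c1 c2) u L =
     (low_exp L e \<and> low_com c1 False L \<and> low_com c2 False L)"
| "low_com (For x lo hi c) u L =
     (public_exp lo \<and> public_exp hi \<and> low_exp L lo \<and> low_exp L hi \<and> low_com c u (insert x L))"

text \<open>Used to weaken the agreement reached after a branch or a loop body back to the one
  before it.\<close>

lemma low_after_superset: "L \<subseteq> low_after c L"
  by (induction c arbitrary: L) (fastforce split: var.split)+

lemma agree_mono: "agree L \<sigma> \<sigma>' \<Longrightarrow> K \<subseteq> L \<Longrightarrow> agree K \<sigma> \<sigma>'"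
  by (auto simp: agree_def)

lemma agree_set_var:
  "agree L \<sigma> \<sigma>' \<Longrightarrow> agree (insert x L) (set_var (Pub x) a \<sigma>) (set_var (Pub x) a \<sigma>')"
  by (simp add: agree_def set_var_def)

lemma agree_set_priv [simp]:
  "agree L (set_var (Priv x) a \<sigma>) \<sigma>' = agree L \<sigma> \<sigma>'"
  "agree L \<sigma> (set_var (Priv x) a \<sigma>') = agree L \<sigma> \<sigma>'"
  by (simp_all add: agree_def set_var_def)

lemma agree_set_cell [simp]:
  "agree L (set_cell A is a \<sigma>) \<sigma>' = agree L \<sigma> \<sigma>'"
  "agree L \<sigma> (set_cell A is a \<sigma>') = agree L \<sigma> \<sigma>'"
  by (simp_all add: agree_def set_cell_def)

lemma eval_public_cong:
  "agree L \<sigma> \<sigma>' \<Longrightarrow> public_exp e \<Longrightarrow> low_exp L e \<Longrightarrow> eval \<sigma> e = eval \<sigma>' e"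
  by (induction e rule: public_exp.induct) (auto simp: agree_def)

lemma visible_index_cong:
  "agree L \<sigma> \<sigma>' \<Longrightarrow> low_exp L e \<Longrightarrow> visible_index \<sigma> e = visible_index \<sigma>' e"
  by (auto simp: visible_index_def intro: eval_public_cong)

lemma map_option_eval_cong:
  "agree L \<sigma> \<sigma>' \<Longrightarrow> \<forall>e\<in>set_option js. public_exp e \<and> low_exp L e \<Longrightarrow>
    map_option (eval \<sigma>) js = map_option (eval \<sigma>') js"
  by (cases js) (auto intro: eval_public_cong)

lemma exp_trace_cong:
  "agree L \<sigma> \<sigma>' \<Longrightarrow> low_exp L e \<Longrightarrow> exp_trace \<sigma> e = exp_trace \<sigma>' e"
proof (induction L e rule: low_exp.induct)
  case (5 L A js "is")
  have "concat (map (exp_trace \<sigma>) is) = concat (map (exp_trace \<sigma>') is)"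
    using 5 by (intro arg_cong[where f = concat] map_cong) auto
  moreover have "map (visible_index \<sigma>) is = map (visible_index \<sigma>') is"
    using 5 by (auto intro: visible_index_cong)
  moreover have "map_option (eval \<sigma>) js = map_option (eval \<sigma>') js"
    using 5 by (auto intro: map_option_eval_cong)
  ultimately show ?case
    using 5 by (auto split: option.split)
qed auto

text \<open>\<open>f\<close> and \<open>g\<close> stand for one loop body under possibly different
  flags. The claim is over \<open>L\<close> only, since without iterations the counter is never
  set.\<close>

lemma iterate_cong:
  assumes body: "\<And>\<sigma> \<sigma>'. agree (insert x L) \<sigma> \<sigma>' \<Longrightarrow>
      snd (f \<sigma>) = snd (g \<sigma>') \<and> agree (insert x L) (fst (f \<sigma>)) (fst (g \<sigma>'))"
    and "agree L \<sigma> \<sigma>'"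
  shows "snd (iterate x f as \<sigma>) = snd (iterate x g as \<sigma>') \<and>
    agree L (fst (iterate x f as \<sigma>)) (fst (iterate x g as \<sigma>'))"
  using assms(2)
proof (induction as arbitrary: \<sigma> \<sigma>')
  case (Cons a as)
  \<comment> \<open>Both runs give the counter the same value \<open>a\<close>, which supplies the
    stronger agreement that \<open>body\<close> expects.\<close>
  note step = body[OF agree_set_var[OF Cons.prems, where a = a]]
  then have "agree L (fst (f (set_var (Pub x) a \<sigma>))) (fst (g (set_var (Pub x) a \<sigma>')))"
    by (auto intro: agree_mono)
  from Cons.IH[OF this] step show ?case
    by (simp add: case_prod_beta)
qed simp

text \<open>The flags \<open>act\<close> and \<open>act'\<close> are kept independent unless
  \<open>u\<close> holds, because under a private condition one run may act where the other is a
  dummy. The traces still coincide, as effects that differ are confined to private variables and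
  array cells.\<close>

theorem exec_cong:
  assumes "low_com c u L" "agree L \<sigma> \<sigma>'" "u \<Longrightarrow> act \<and> act'"
  shows "snd (exec c act \<sigma>) = snd (exec c act' \<sigma>') \<and>
    agree (low_after c L) (fst (exec c act \<sigma>)) (fst (exec c act' \<sigma>'))"
  using assms
proof (induction c arbitrary: u L \<sigma> \<sigma>' act act')
  case Skip
  then show ?case by simp
next
  case (Assign x e)
  have tr: "exp_trace \<sigma> e = exp_trace \<sigma>' e"
    using Assign.prems by (auto intro: exp_trace_cong)
  show ?case
  \<comment> \<open>A public target displays its value, so \<open>u\<close> must force both runs to
    take effect; a private one hides it, so the flags may differ.\<close>
  proof (cases x)
    case (Pub y)
    then have "eval \<sigma> e = eval \<sigma>' e"
      using Assign.prems by (auto intro: eval_public_cong)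
    with Pub tr Assign.prems show ?thesis
      by (auto simp: set_var_def agree_def)
  qed (use tr Assign.prems in auto)
next
  case (Write A js "is" e)
  \<comment> \<open>A write event carries the same data as a read event at that cell, after the same
    superscript and index traces, so the lemma for reads covers it.\<close>
  then have "exp_trace \<sigma> e = exp_trace \<sigma>' e"
    and "exp_trace \<sigma> (Read A js is) = exp_trace \<sigma>' (Read A js is)"
    by (auto intro!: exp_trace_cong simp del: exp_trace.simps)
  then show ?case
    using Write.prems by (simp add: Let_def)
next
  case (Seq c1 c2)
  from Seq.prems have c1: "snd (exec c1 act \<sigma>) = snd (exec c1 act' \<sigma>')"
    "agree (low_after c1 L) (fst (exec c1 act \<sigma>)) (fst (exec c1 act' \<sigma>'))"
    using Seq.IH(1)[of u L \<sigma> \<sigma>' act act'] by auto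
  with Seq.IH(2)[OF _ c1(2), of u act act'] Seq.prems show ?case
    by (auto simp: case_prod_beta)
next
  case (If e c1 c2)
  let ?a = "act \<and> eval \<sigma> e \<noteq> 0" and ?a' = "act' \<and> eval \<sigma>' e \<noteq> 0"
  let ?\<tau> = "fst (exec c1 ?a \<sigma>)" and ?\<tau>' = "fst (exec c1 ?a' \<sigma>')"
  \<comment> \<open>The condition may be private, so \<open>?a\<close> and \<open>?a'\<close> can
    differ and the induction hypothesis is taken with \<open>u\<close> false.\<close>
  have c1: "snd (exec c1 ?a \<sigma>) = snd (exec c1 ?a' \<sigma>')" "agree (low_after c1 L) ?\<tau> ?\<tau>'"
    using If.IH(1)[of False L \<sigma> \<sigma>' ?a ?a'] If.prems by auto
  then have "agree L ?\<tau> ?\<tau>'"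
    using agree_mono low_after_superset by blast
  then have c2: "snd (exec c2 b ?\<tau>) = snd (exec c2 b' ?\<tau>')"
    "agree L (fst (exec c2 b ?\<tau>)) (fst (exec c2 b' ?\<tau>'))" for b b'
    using If.IH(2)[of False L ?\<tau> ?\<tau>' b b'] If.prems agree_mono low_after_superset by auto
  have "exp_trace \<sigma> e = exp_trace \<sigma>' e"
    using If.prems by (auto intro: exp_trace_cong)
  with c1 c2 show ?case
    by (simp add: case_prod_beta Let_def)
next
  case (For x lo hi c)
  have bounds: "eval \<sigma> lo = eval \<sigma>' lo" "eval \<sigma> hi = eval \<sigma>' hi"
    "exp_trace \<sigma> lo = exp_trace \<sigma>' lo" "exp_trace \<sigma> hi = exp_trace \<sigma>' hi"
    using For.prems by (auto intro: eval_public_cong exp_trace_cong)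
  have body: "snd (exec c act \<tau>) = snd (exec c act' \<tau>') \<and>
      agree (insert x L) (fst (exec c act \<tau>)) (fst (exec c act' \<tau>'))"
    if "agree (insert x L) \<tau> \<tau>'" for \<tau> \<tau>'
    using For.IH[of u "insert x L" \<tau> \<tau>' act act'] that For.prems
      agree_mono[OF _ low_after_superset] by auto
  \<comment> \<open>If \<open>x\<close> is in \<open>L\<close>, the saved counter values agree;
    otherwise \<open>x\<close> is not compared.\<close>
  have restore: "agree L (set_var (Pub x) (vars \<sigma> (Pub x)) \<tau>)
      (set_var (Pub x) (vars \<sigma>' (Pub x)) \<tau>')" if "agree L \<tau> \<tau>'" for \<tau> \<tau>'
    using that For.prems(2) by (auto simp: agree_def set_var_def)
  from iterate_cong[OF body For.prems(2)] bounds restore show ?case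
    by (simp add: case_prod_beta)
qed

text \<open>The assignment closing \<open>init_ranks\<close> puts \<open>j\<close> into the low set,
  which admits the superscripts in \<open>iterate_ranks\<close>; the only variable assigned in a
  branch is the private \<open>v\<close>.\<close>

lemma low_com_pagerank: "low_com pagerank True {''n'', ''m'', ''l''}"
  by (simp add: pagerank_def build_N_def init_ranks_def iterate_ranks_def)

lemma trace_pagerank_cong:
  "agree {''n'', ''m'', ''l''} \<sigma> \<sigma>' \<Longrightarrow> trace pagerank \<sigma> = trace pagerank \<sigma>'"
  unfolding trace_def using exec_cong[OF low_com_pagerank] by blast

theorem theorem5:
  shows "data_oblivious (\<lambda>\<sigma>. \<exists>n m l s G. pagerank_input n m l s G \<sigma>) {''n'', ''m'', ''l''} pagerank \<and>
    (\<exists>T. \<forall>(n::nat) (m::nat) (l::nat) (s::rat) (G::nat pair_pre_digraph) \<sigma>.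
       pagerank_input n m l s G \<sigma> \<longrightarrow> trace pagerank \<sigma> = T n m l)"
proof
  show "data_oblivious (\<lambda>\<sigma>. \<exists>n m l s G. pagerank_input n m l s G \<sigma>) {''n'', ''m'', ''l''} pagerank"
    unfolding data_oblivious_def by (auto intro!: trace_pagerank_cong simp: agree_def)
  \<comment> \<open>The trace of this reference memory, fixed by \<open>n\<close>, \<open>m\<close>
    and \<open>l\<close> alone, is the witness for \<open>T\<close>. That it encodes no graph does
    not matter: \<open>trace_pagerank_cong\<close> compares any memories agreeing on these three
    variables.\<close>
  define \<sigma>\<^sub>0 :: "nat \<Rightarrow> nat \<Rightarrow> nat \<Rightarrow> mem" where
    "\<sigma>\<^sub>0 n m l = \<lparr>vars = (\<lambda>_. 0)(Pub ''n'' := of_nat n, Pub ''m'' := of_nat m,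
       Pub ''l'' := of_nat l), arrs = \<lambda>_ _. 0\<rparr>" for n m l
  have "trace pagerank \<sigma> = trace pagerank (\<sigma>\<^sub>0 n m l)" if "pagerank_input n m l s G \<sigma>"
    for n m l s G \<sigma>
    using that by (intro trace_pagerank_cong) (simp add: agree_def \<sigma>\<^sub>0_def pagerank_input_def)
  then show "\<exists>T. \<forall>(n::nat) (m::nat) (l::nat) (s::rat) (G::nat pair_pre_digraph) \<sigma>.
       pagerank_input n m l s G \<sigma> \<longrightarrow> trace pagerank \<sigma> = T n m l"
    by (intro exI[of _ "\<lambda>n m l. trace pagerank (\<sigma>\<^sub>0 n m l)"]) blast
qed

end
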